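(* Let $X\subset\mathbb{R}^n$ be finite and $f\colon X\to\{-1,1\}$. Then for every integer $k\geq2$, \[\deg_{\pm}(\underbrace{f\wedge f\wedge\cdots\wedge f}_{k})\leq(8k\log k)\cdot\deg_{\pm}(f\wedge f).\]
   Context: Boolean values: $-1$ is true, $+1$ false. $f\wedge\cdots\wedge f$ ($k$ copies) denotes $(x_1,\dots,x_k)\mapsto f(x_1)\wedge\cdots\wedge f(x_k)$ on $X^k$ (independent copies). The threshold degree $\deg_{\pm}(h)$ is the least total degree of a real polynomial $p$ with $h(z)p(z)>0$ on the domain of $h$. $\log$ is to base $2$. *)

theory Defs
  imports "HOL-Analysis.Analysis" "HOL-Library.Poly_Mapping"
begin

text \<open>
  Real polynomials in indeterminates of type \<open>'v\<close>: a polynomial maps each monomial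
  (a finitely supported exponent vector) to its coefficient.
\<close>

type_synonym 'v rpoly = "('v \<Rightarrow>\<^sub>0 nat) \<Rightarrow>\<^sub>0 real"

definition monomial_degree :: "('v \<Rightarrow>\<^sub>0 nat) \<Rightarrow> nat" where
  "monomial_degree m = (\<Sum>v\<in>Poly_Mapping.keys m. Poly_Mapping.lookup m v)"

definition total_degree :: "'v rpoly \<Rightarrow> nat" where
  "total_degree p = Max (insert 0 (monomial_degree ` Poly_Mapping.keys p))"

definition indets :: "'v rpoly \<Rightarrow> 'v set" where
  "indets p = (\<Union>m\<in>Poly_Mapping.keys p. Poly_Mapping.keys m)"

definition eval_rpoly :: "'v rpoly \<Rightarrow> ('v \<Rightarrow> real) \<Rightarrow> real" where
  "eval_rpoly p z =
     (\<Sum>m\<in>Poly_Mapping.keys p. Poly_Mapping.lookup p m *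
        (\<Prod>v\<in>Poly_Mapping.keys m. z v ^ Poly_Mapping.lookup m v))"

text \<open>
  The points of the domain \<open>D\<close> live in a space with real coordinates indexed by \<open>V\<close>;
  \<open>c z v\<close> is the coordinate of the point \<open>z\<close> with index \<open>v \<in> V\<close>. For finite \<open>D\<close> whose points
  are separated by their coordinates, and \<open>h\<close> nonvanishing on \<open>D\<close>, a sign-representing
  polynomial always exists (by interpolation), so the minimum is attained.
\<close>

definition threshold_degree ::
  "'v set \<Rightarrow> ('a \<Rightarrow> 'v \<Rightarrow> real) \<Rightarrow> 'a set \<Rightarrow> ('a \<Rightarrow> real) \<Rightarrow> nat" where
  "threshold_degree V c D h =
     (LEAST d. \<exists>p :: 'v rpoly. indets p \<subseteq> V \<and> total_degree p = d \<and>
        (\<forall>z\<in>D. h z * eval_rpoly p (c z) > 0))"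

text \<open>
  A point of \<open>(\<real>\<^sup>n)\<^sup>k\<close> is a family \<open>x\<close> of vectors \<open>x 0, \<dots>, x (k - 1)\<close>; its \<open>n k\<close> real
  coordinates \<open>x i $ j\<close> are indexed by the pairs \<open>(i, j)\<close>. Truth values are \<open>-1\<close> (true) and
  \<open>1\<close> (false).
\<close>

definition conj_copies :: "nat \<Rightarrow> ('b \<Rightarrow> real) \<Rightarrow> (nat \<Rightarrow> 'b) \<Rightarrow> real" where
  "conj_copies k f x = (if \<forall>i<k. f (x i) = -1 then -1 else 1)"

definition threshold_degree_conj ::
  "nat \<Rightarrow> (real ^ 'n) set \<Rightarrow> (real ^ 'n \<Rightarrow> real) \<Rightarrow> nat" where
  "threshold_degree_conj k X f =
     threshold_degree ({..<k} \<times> (UNIV :: 'n set)) (\<lambda>x (i, j). x i $ j)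
       (PiE {..<k} (\<lambda>_. X)) (conj_copies k f)"

end

theory Submission
  imports Defs
begin

text \<open>
  Let \<open>\<phi>(x, y)\<close> of degree \<open>d\<close> be positive when \<open>f x\<close> and \<open>f y\<close> are both true and negative otherwise.
  Write \<open>T\<close> and \<open>F\<close> for the true and false points of \<open>X\<close>. For nonnegative weights \<open>c\<close> put
  \<open>A(x) = \<Sum>y\<in>T. c y \<phi>(x, y)\<close> and \<open>B(x) = - (\<Sum>y\<in>F. c y \<phi>(x, y))\<close>, and define the same sums
  with the two arguments of \<open>\<phi>\<close> exchanged. Then \<open>A / B\<close> is positive on \<open>T\<close> and negative on \<open>F\<close>.
  After flipping the sign of \<open>\<phi>\<close> on \<open>F \<times> F\<close>, Ville's theorem of the alternative yields weights
  for which either \<open>\<bar>A / B\<bar>\<close> is at most 1 on \<open>T\<close> and at least 1 on \<open>F\<close>, or the transposed ratio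
  satisfies the reverse inequalities. In the first case \<open>(2A - B)\<^sup>2 / B\<^sup>2\<close> is at most 1 on \<open>T\<close>
  and at least 9 on \<open>F\<close>; in the second, \<open>(2A + B)\<^sup>2 / B\<^sup>2\<close> is at least 9 on \<open>T\<close> and at most 1
  on \<open>F\<close>. Either way there is a quotient \<open>N / D\<close> of polynomials of degree \<open>2d\<close> that is below \<open>1/2\<close>
  on \<open>T\<close> and above 1 on \<open>F\<close>. With \<open>2\<^sup>m \<ge> k\<close>, the sign of \<open>(\<Sum>i<k. (N(x\<^sub>i) / D(x\<^sub>i))\<^sup>m) - 1\<close>
  represents the \<open>k\<close>-fold conjunction, and clearing denominators costs degree \<open>2dmk\<close>.
\<close>

section \<open>Theorems of the alternative\<close>

text \<open>Used to choose the value of an eliminated coordinate between its lower and upper bounds.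
  One side may be empty; then any value beyond the extremum of the other side serves.\<close>

lemma exists_strictly_between:
  fixes A B :: "real set"
  assumes "finite A" "finite B" "\<And>a b. a \<in> A \<Longrightarrow> b \<in> B \<Longrightarrow> a < b"
  shows "\<exists>t. (\<forall>a\<in>A. a < t) \<and> (\<forall>b\<in>B. t < b)"
proof (cases "A = {} \<or> B = {}")
  case True
  then show ?thesis
  proof
    assume "A = {}"
    moreover have "\<forall>b\<in>B. Min B - 1 < b"
      using Min_le[OF assms(2)] by force
    ultimately show ?thesis by blast
  next
    assume "B = {}"
    moreover have "\<forall>a\<in>A. a < Max A + 1"
      using Max_ge[OF assms(1)] by force
    ultimately show ?thesis by blast
  qed
next
  case False
  then have "Max A < Min B" using assms by simp
  then obtain t where "Max A < t" "t < Min B" using dense by blast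
  then show ?thesis using assms(1,2) False by auto
qed

text \<open>Fourier--Motzkin elimination of the coordinates in \<open>I\<close>.\<close>

lemma gordan_set:
  fixes S :: "('i \<Rightarrow> real) set"
  assumes "finite I" "finite S"
  shows "(\<exists>a. \<forall>v\<in>S. 0 < (\<Sum>i\<in>I. a i * v i)) \<or>
    (\<exists>c. (\<forall>v\<in>S. 0 \<le> c v) \<and> (\<exists>v\<in>S. 0 < c v) \<and> (\<forall>i\<in>I. (\<Sum>v\<in>S. c v * v i) = 0))"
  using assms
proof (induction I arbitrary: S rule: finite_induct)
  case empty
  show ?case
  proof (cases "S = {}")
    case False
    then have "\<exists>v\<in>S. (0::real) < (\<lambda>_. 1) v" by auto
    then show ?thesis by (intro disjI2 exI[of _ "\<lambda>_. 1"]) auto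
  qed auto
next
  case (insert k I)
  define P where "P = {v \<in> S. 0 < v k}"
  define N where "N = {v \<in> S. v k < 0}"
  define Z where "Z = {v \<in> S. v k = 0}"
  \<comment> \<open>For \<open>p \<in> P\<close> and \<open>n \<in> N\<close> both multipliers
    \<open>- n k\<close> and \<open>p k\<close> are positive, and coordinate \<open>k\<close> of the
    combination cancels.\<close>
  define comb where "comb p n = (\<lambda>i. p i * (- n k) + n i * p k)" for p n :: "'i \<Rightarrow> real"
  define S' where "S' = Z \<union> (\<lambda>(p, n). comb p n) ` (P \<times> N)"
  have fin: "finite P" "finite N" "finite Z" "finite S'"
    using insert.prems by (auto simp: P_def N_def Z_def S'_def)
  from insert.IH[OF fin(4)] show ?case
  proof (elim disjE exE conjE)
    fix a assume a: "\<forall>v\<in>S'. 0 < (\<Sum>i\<in>I. a i * v i)"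
    define L where "L v = (\<Sum>i\<in>I. a i * v i)" for v
    \<comment> \<open>Positivity of the smaller system on \<open>comb p n\<close> says exactly that
      the lower bound which \<open>p\<close> puts on the new coefficient \<open>t\<close> lies below
      the upper bound which \<open>n\<close> puts on it.\<close>
    have "- L p / p k < L n / (- n k)" if "p \<in> P" "n \<in> N" for p n
    proof -
      have "comb p n \<in> S'" using that by (auto simp: S'_def)
      then have "0 < (\<Sum>i\<in>I. a i * comb p n i)" using a by blast
      also have "\<dots> = L p * (- n k) + L n * p k"
        unfolding L_def comb_def sum_distrib_right sum.distrib[symmetric]
        by (rule sum.cong) (auto simp: algebra_simps)
      finally have "0 < L p * (- n k) + L n * p k" .
      then show ?thesis using that by (simp add: P_def N_def field_simps)
    qed
    then have "\<exists>t. (\<forall>a\<in>(\<lambda>p. - L p / p k) ` P. a < t) \<and> (\<forall>b\<in>(\<lambda>n. L n / (- n k)) ` N. t < b)"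
      by (intro exists_strictly_between) (use fin in auto)
    then obtain t where tP: "\<And>p. p \<in> P \<Longrightarrow> - L p / p k < t"
      and tN: "\<And>n. n \<in> N \<Longrightarrow> t < L n / (- n k)" by auto
    have "0 < L v + t * v k" if v: "v \<in> S" for v
    proof -
      consider "v \<in> P" | "v \<in> N" | "v \<in> Z" using v by (force simp: P_def N_def Z_def)
      then show ?thesis
      proof cases
        case 1
        then show ?thesis using tP[OF 1] by (simp add: P_def field_simps)
      next
        case 2
        then show ?thesis using tN[OF 2] by (simp add: N_def field_simps)
      next
        case 3
        then show ?thesis using a by (simp add: L_def S'_def Z_def)
      qed
    qed
    moreover have "(\<Sum>i\<in>insert k I. (a(k := t)) i * v i) = L v + t * v k" for v
    proof -
      have "(\<Sum>i\<in>I. (a(k := t)) i * v i) = L v"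
        unfolding L_def using insert.hyps by (intro sum.cong) auto
      then show ?thesis using insert.hyps by simp
    qed
    ultimately show ?thesis by (intro disjI1 exI[of _ "a(k := t)"]) simp
  next
    fix c assume c: "\<forall>v\<in>S'. 0 \<le> c v" "\<exists>v\<in>S'. 0 < c v" "\<forall>i\<in>I. (\<Sum>v\<in>S'. c v * v i) = 0"
    \<comment> \<open>Elements of \<open>S'\<close> are nontrivial nonnegative combinations of
      elements of \<open>S\<close>, so a dependency among them pulls back to
      \<open>S\<close>.\<close>
    have "\<exists>d. (\<forall>v\<in>S. 0 \<le> d v) \<and> (\<exists>v\<in>S. 0 < d v) \<and> (\<forall>i. w i = (\<Sum>v\<in>S. d v * v i))"
      if w: "w \<in> S'" for w
    proof -
      from w consider "w \<in> Z" | p n where "p \<in> P" "n \<in> N" "w = comb p n"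
        by (auto simp: S'_def)
      then show ?thesis
      proof cases
        case 1
        then show ?thesis using insert.prems
          by (intro exI[of _ "\<lambda>v. if v = w then 1 else 0"])
            (auto simp: Z_def if_distrib[of "\<lambda>x. x * _"] cong: if_cong)
      next
        case 2
        define d where "d v = (if v = p then - n k else 0) + (if v = n then p k else 0)" for v
        have "(\<Sum>v\<in>S. d v * v i) = w i" for i
        proof -
          have "(\<Sum>v\<in>S. d v * v i)
              = (\<Sum>v\<in>S. if v = p then - n k * v i else 0) + (\<Sum>v\<in>S. if v = n then p k * v i else 0)"
            unfolding sum.distrib[symmetric] by (rule sum.cong) (auto simp: d_def algebra_simps)
          also have "\<dots> = w i"
            using 2 insert.prems by (simp add: P_def N_def comb_def)
          finally show ?thesis .
        qed
        moreover have "\<forall>v\<in>S. 0 \<le> d v" "p \<in> S" "0 < d p"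
          using 2 by (auto simp: d_def P_def N_def)
        ultimately show ?thesis by (intro exI[of _ d]) auto
      qed
    qed
    then have "\<exists>d. \<forall>w\<in>S'. (\<forall>v\<in>S. 0 \<le> d w v) \<and> (\<exists>v\<in>S. 0 < d w v) \<and>
        (\<forall>i. w i = (\<Sum>v\<in>S. d w v * v i))"
      by (intro bchoice) blast
    then obtain d where d: "\<And>w v. w \<in> S' \<Longrightarrow> v \<in> S \<Longrightarrow> 0 \<le> d w v"
      "\<And>w. w \<in> S' \<Longrightarrow> \<exists>v\<in>S. 0 < d w v"
      "\<And>w i. w \<in> S' \<Longrightarrow> w i = (\<Sum>v\<in>S. d w v * v i)" by blast
    define c' where "c' v = (\<Sum>w\<in>S'. c w * d w v)" for v
    have nonneg: "\<forall>v\<in>S. 0 \<le> c' v"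
      unfolding c'_def using c d by (intro ballI sum_nonneg mult_nonneg_nonneg) auto
    obtain w where w: "w \<in> S'" "0 < c w" using c by blast
    obtain u where u: "u \<in> S" "0 < d w u" using d(2) w by blast
    have pos: "0 < c' u"
      unfolding c'_def using w u c d fin by (intro sum_pos2[of _ w]) auto
    have "(\<Sum>v\<in>S. c' v * v i) = 0" if i: "i \<in> insert k I" for i
    proof -
      have "(\<Sum>v\<in>S. c' v * v i) = (\<Sum>w\<in>S'. c w * (\<Sum>v\<in>S. d w v * v i))"
        unfolding c'_def sum_distrib_right sum_distrib_left by (subst sum.swap) (simp add: mult.assoc)
      also have "\<dots> = (\<Sum>w\<in>S'. c w * w i)" using d(3) by (intro sum.cong) auto
      also have "\<dots> = 0"
      proof (cases "i = k")
        case True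
        \<comment> \<open>The induction hypothesis says nothing about coordinate \<open>k\<close>;
          there the sum vanishes because \<open>S'\<close> was built with that coordinate equal to
          0.\<close>
        have "w k = 0" if "w \<in> S'" for w using that by (auto simp: S'_def Z_def comb_def)
        then show ?thesis unfolding True by (intro sum.neutral) simp
      qed (use i c in auto)
      finally show ?thesis .
    qed
    then show ?thesis using nonneg pos u(1) by blast
  qed
qed

text \<open>Indices carrying equal vectors collapse in the set version. Choosing one index per
  vector (the set \<open>U\<close>) and giving it the whole weight, with 0 at the other indices,
  recovers the indexed form.\<close>

lemma gordan_family:
  fixes v :: "'j \<Rightarrow> 'i \<Rightarrow> real"
  assumes "finite I" "finite J"
  shows "(\<exists>a. \<forall>j\<in>J. 0 < (\<Sum>i\<in>I. a i * v j i)) \<or>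
    (\<exists>c. (\<forall>j\<in>J. 0 \<le> c j) \<and> (\<exists>j\<in>J. 0 < c j) \<and> (\<forall>i\<in>I. (\<Sum>j\<in>J. c j * v j i) = 0))"
proof -
  obtain U where U: "U \<subseteq> J" "inj_on v U" "v ` J = v ` U"
    using subset_image_inj[of "v ` J" v J] by auto
  from gordan_set[OF assms(1) finite_imageI[OF assms(2), of v]] show ?thesis
  proof (elim disjE exE conjE)
    fix c assume c: "\<forall>w\<in>v ` J. 0 \<le> c w" "\<exists>w\<in>v ` J. 0 < c w"
      "\<forall>i\<in>I. (\<Sum>w\<in>v ` J. c w * w i) = 0"
    define c' where "c' j = (if j \<in> U then c (v j) else 0)" for j
    have "(\<Sum>j\<in>J. c' j * v j i) = (\<Sum>w\<in>v ` J. c w * w i)" for i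
    proof -
      have "(\<Sum>j\<in>J. c' j * v j i) = (\<Sum>j\<in>U. c' j * v j i)"
        using U(1) assms(2) by (intro sum.mono_neutral_right) (auto simp: c'_def)
      also have "\<dots> = (\<Sum>w\<in>v ` J. c w * w i)"
        unfolding U(3) by (simp add: sum.reindex[OF U(2)] c'_def)
      finally show ?thesis .
    qed
    moreover have "\<exists>j\<in>J. 0 < c' j"
    proof -
      obtain w where "w \<in> v ` U" "0 < c w" using c(2) unfolding U(3) by blast
      then show ?thesis using U(1) by (auto simp: c'_def)
    qed
    moreover have "\<forall>j\<in>J. 0 \<le> c' j" using c(1) by (auto simp: c'_def)
    ultimately show ?thesis using c(3) by (intro disjI2 exI[of _ c']) auto
  qed auto
qed

text \<open>Gordan's alternative for the columns of \<open>M\<close> together with the unit vectors.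
  Positivity against unit vectors makes every \<open>a i\<close> positive; in the other alternative
  the weights of the unit vectors become the slack in the inequalities.\<close>

lemma ville_alternative:
  fixes M :: "'i \<Rightarrow> 'j \<Rightarrow> real"
  assumes "finite I" "finite J"
  shows "(\<exists>a. (\<forall>i\<in>I. 0 < a i) \<and> (\<forall>j\<in>J. 0 < (\<Sum>i\<in>I. a i * M i j))) \<or>
    (\<exists>c. (\<forall>j\<in>J. 0 \<le> c j) \<and> (\<exists>j\<in>J. 0 < c j) \<and> (\<forall>i\<in>I. (\<Sum>j\<in>J. c j * M i j) \<le> 0))"
proof -
  define v where "v s i = (case s of Inl j \<Rightarrow> M i j | Inr l \<Rightarrow> if i = l then 1 else 0)"
    for s :: "'j + 'i" and i
  have v_simps: "v (Inl j) i = M i j" "v (Inr l) i = (if i = l then 1 else 0)" for j l i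
    by (auto simp: v_def)
  have "finite (J <+> I)" using assms by simp
  from gordan_family[OF assms(1) this, of v] show ?thesis
  proof (elim disjE exE conjE)
    fix a assume a: "\<forall>s\<in>J <+> I. 0 < (\<Sum>i\<in>I. a i * v s i)"
    have "0 < a l" if "l \<in> I" for l
      using a[rule_format, of "Inr l"] that assms(1)
      by (simp add: v_simps if_distrib[of "\<lambda>x. _ * x"] InrI cong: if_cong)
    moreover have "0 < (\<Sum>i\<in>I. a i * M i j)" if "j \<in> J" for j
      using a[rule_format, of "Inl j"] that by (simp add: v_simps InlI)
    ultimately show ?thesis by blast
  next
    fix c assume c: "\<forall>s\<in>J <+> I. 0 \<le> c s" "\<exists>s\<in>J <+> I. 0 < c s"
      "\<forall>i\<in>I. (\<Sum>s\<in>J <+> I. c s * v s i) = 0"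
    have eq: "(\<Sum>j\<in>J. c (Inl j) * M i j) = - c (Inr i)" if "i \<in> I" for i
    proof -
      have "0 = (\<Sum>j\<in>J. c (Inl j) * M i j) + (\<Sum>l\<in>I. c (Inr l) * (if i = l then 1 else 0))"
        using c(3) that assms by (simp add: sum.Plus v_simps)
      also have "(\<Sum>l\<in>I. c (Inr l) * (if i = l then 1 else 0)) = c (Inr i)"
        using that assms(1) by (simp add: if_distrib[of "\<lambda>x. _ * x"] cong: if_cong)
      finally show ?thesis by simp
    qed
    have nonneg: "\<forall>j\<in>J. 0 \<le> c (Inl j)" "\<forall>i\<in>I. 0 \<le> c (Inr i)" using c(1) by auto
    \<comment> \<open>If all column weights vanished, \<open>eq\<close> would force the slack
      weights to vanish too, against the nontriviality of \<open>c\<close>.\<close>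
    have "\<exists>j\<in>J. 0 < c (Inl j)"
    proof (rule ccontr)
      assume "\<not> ?thesis"
      then have zero: "\<forall>j\<in>J. c (Inl j) = 0" using nonneg(1) by force
      then have "\<forall>i\<in>I. c (Inr i) = 0" using eq by simp
      with zero c(2) show False by auto
    qed
    then show ?thesis using nonneg eq
      by (intro disjI2 exI[of _ "\<lambda>j. c (Inl j)"]) auto
  qed
qed

section \<open>Polynomial functions\<close>

text \<open>A function with an upper bound on its degree replaces the polynomial itself, so that
  degree bounds follow from closure rules and cancellation of leading terms does no harm.\<close>

definition poly_function :: "'v set \<Rightarrow> nat \<Rightarrow> (('v \<Rightarrow> real) \<Rightarrow> real) \<Rightarrow> bool" where
  "poly_function V d g \<longleftrightarrow>
     (\<exists>p :: 'v rpoly. indets p \<subseteq> V \<and> total_degree p \<le> d \<and> eval_rpoly p = g)"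

definition eval_monomial :: "('v \<Rightarrow>\<^sub>0 nat) \<Rightarrow> ('v \<Rightarrow> real) \<Rightarrow> real" where
  "eval_monomial m z = (\<Prod>v\<in>Poly_Mapping.keys m. z v ^ Poly_Mapping.lookup m v)"

lemma total_degree_le_iff:
  "total_degree p \<le> d \<longleftrightarrow> (\<forall>m\<in>Poly_Mapping.keys p. monomial_degree m \<le> d)"
  unfolding total_degree_def by (subst Max_le_iff) auto

text \<open>Padding with zero coefficients lets polynomials with different supports be evaluated
  over one common index set.\<close>

lemma eval_rpoly_superset:
  assumes "finite M" "Poly_Mapping.keys p \<subseteq> M"
  shows "eval_rpoly p z = (\<Sum>m\<in>M. Poly_Mapping.lookup p m * eval_monomial m z)"
  unfolding eval_rpoly_def eval_monomial_def[symmetric]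
  using assms by (intro sum.mono_neutral_left) (auto simp: in_keys_iff)

lemma eval_monomial_superset:
  assumes "finite W" "Poly_Mapping.keys m \<subseteq> W"
  shows "eval_monomial m z = (\<Prod>v\<in>W. z v ^ Poly_Mapping.lookup m v)"
  unfolding eval_monomial_def
  using assms by (intro prod.mono_neutral_left) (auto simp: in_keys_iff)

lemma monomial_degree_superset:
  assumes "finite W" "Poly_Mapping.keys m \<subseteq> W"
  shows "monomial_degree m = (\<Sum>v\<in>W. Poly_Mapping.lookup m v)"
  unfolding monomial_degree_def
  using assms by (intro sum.mono_neutral_left) (auto simp: in_keys_iff)

lemma eval_monomial_add: "eval_monomial (m + n) z = eval_monomial m z * eval_monomial n z"
proof -
  let ?W = "Poly_Mapping.keys m \<union> Poly_Mapping.keys n"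
  have "eval_monomial (m + n) z = (\<Prod>v\<in>?W. z v ^ Poly_Mapping.lookup (m + n) v)"
    by (rule eval_monomial_superset) (auto dest: Poly_Mapping.keys_add[THEN subsetD])
  also have "\<dots> = (\<Prod>v\<in>?W. z v ^ Poly_Mapping.lookup m v) * (\<Prod>v\<in>?W. z v ^ Poly_Mapping.lookup n v)"
    by (simp add: lookup_add power_add prod.distrib)
  finally show ?thesis
    by (simp add: eval_monomial_superset[of ?W m] eval_monomial_superset[of ?W n])
qed

lemma monomial_degree_add: "monomial_degree (m + n) = monomial_degree m + monomial_degree n"
proof -
  let ?W = "Poly_Mapping.keys m \<union> Poly_Mapping.keys n"
  have "monomial_degree (m + n) = (\<Sum>v\<in>?W. Poly_Mapping.lookup (m + n) v)"
    by (rule monomial_degree_superset) (auto dest: Poly_Mapping.keys_add[THEN subsetD])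
  then show ?thesis
    by (simp add: lookup_add sum.distrib monomial_degree_superset[of ?W m]
        monomial_degree_superset[of ?W n])
qed

lemma poly_function_monomial:
  assumes "Poly_Mapping.keys m \<subseteq> V" "monomial_degree m \<le> d"
  shows "poly_function V d (\<lambda>z. c * eval_monomial m z)"
proof -
  let ?p = "Poly_Mapping.single m c"
  have keys: "Poly_Mapping.keys ?p \<subseteq> {m}" by simp
  have "eval_rpoly ?p = (\<lambda>z. c * eval_monomial m z)"
    by (rule ext, subst eval_rpoly_superset[OF _ keys]) auto
  moreover have "indets ?p \<subseteq> V" "total_degree ?p \<le> d"
    using assms keys unfolding indets_def total_degree_le_iff by blast+
  ultimately show ?thesis unfolding poly_function_def by blast
qed

lemma poly_function_const: "poly_function V d (\<lambda>_. c)"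
  using poly_function_monomial[of 0 V d c] by (simp add: eval_monomial_def monomial_degree_def)

lemma poly_function_var:
  assumes "v \<in> V" "1 \<le> d"
  shows "poly_function V d (\<lambda>z. z v)"
  using poly_function_monomial[of "Poly_Mapping.single v 1" V d 1] assms
  by (simp add: eval_monomial_def monomial_degree_def)

lemma poly_function_mono:
  assumes "poly_function V d g" "d \<le> e"
  shows "poly_function V e g"
  using assms unfolding poly_function_def by (blast intro: order_trans)

lemma poly_function_add:
  assumes "poly_function V d g" "poly_function V d h"
  shows "poly_function V d (\<lambda>z. g z + h z)"
proof -
  obtain p q where p: "indets p \<subseteq> V" "total_degree p \<le> d" "eval_rpoly p = g"
    and q: "indets q \<subseteq> V" "total_degree q \<le> d" "eval_rpoly q = h"
    using assms unfolding poly_function_def by blast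
  let ?K = "Poly_Mapping.keys p \<union> Poly_Mapping.keys q"
  have keys: "Poly_Mapping.keys (p + q) \<subseteq> ?K" by (rule Poly_Mapping.keys_add)
  have "eval_rpoly (p + q) = (\<lambda>z. g z + h z)"
  proof
    fix z
    have "g z = (\<Sum>m\<in>?K. Poly_Mapping.lookup p m * eval_monomial m z)"
      "h z = (\<Sum>m\<in>?K. Poly_Mapping.lookup q m * eval_monomial m z)"
      unfolding p(3)[symmetric] q(3)[symmetric] by (auto intro!: eval_rpoly_superset)
    then show "eval_rpoly (p + q) z = g z + h z"
      by (simp add: eval_rpoly_superset[OF _ keys] lookup_add sum.distrib algebra_simps)
  qed
  moreover have "indets (p + q) \<subseteq> V" "total_degree (p + q) \<le> d"
    using p q keys unfolding indets_def total_degree_le_iff by blast+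
  ultimately show ?thesis unfolding poly_function_def by blast
qed

lemma poly_function_sum:
  assumes "\<And>i. i \<in> I \<Longrightarrow> poly_function V d (g i)"
  shows "poly_function V d (\<lambda>z. \<Sum>i\<in>I. g i z)"
  using assms
  by (induction I rule: infinite_finite_induct)
    (auto intro: poly_function_const poly_function_add)

text \<open>Reduces products and substitutions to single monomials, where degrees simply
  add.\<close>

lemma poly_function_expand:
  assumes "poly_function V d g"
  obtains M c where "finite M" "\<And>m. m \<in> M \<Longrightarrow> Poly_Mapping.keys m \<subseteq> V"
    "\<And>m. m \<in> M \<Longrightarrow> monomial_degree m \<le> d" "g = (\<lambda>z. \<Sum>m\<in>M. c m * eval_monomial m z)"
proof -
  obtain p where p: "indets p \<subseteq> V" "total_degree p \<le> d" "eval_rpoly p = g"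
    using assms unfolding poly_function_def by blast
  show thesis
  proof (rule that[of "Poly_Mapping.keys p" "Poly_Mapping.lookup p"])
    show "g = (\<lambda>z. \<Sum>m\<in>Poly_Mapping.keys p. Poly_Mapping.lookup p m * eval_monomial m z)"
      using p(3) by (auto simp: eval_rpoly_def eval_monomial_def)
  qed (use p in \<open>auto simp: indets_def total_degree_le_iff\<close>)
qed

lemma poly_function_mult:
  assumes "poly_function V d g" "poly_function V e h"
  shows "poly_function V (d + e) (\<lambda>z. g z * h z)"
proof -
  obtain M a where M: "\<And>m. m \<in> M \<Longrightarrow> Poly_Mapping.keys m \<subseteq> V"
    "\<And>m. m \<in> M \<Longrightarrow> monomial_degree m \<le> d" "g = (\<lambda>z. \<Sum>m\<in>M. a m * eval_monomial m z)"
    using poly_function_expand[OF assms(1)] by metis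
  obtain N b where N: "\<And>m. m \<in> N \<Longrightarrow> Poly_Mapping.keys m \<subseteq> V"
    "\<And>m. m \<in> N \<Longrightarrow> monomial_degree m \<le> e" "h = (\<lambda>z. \<Sum>m\<in>N. b m * eval_monomial m z)"
    using poly_function_expand[OF assms(2)] by metis
  have "(\<lambda>z. g z * h z) = (\<lambda>z. \<Sum>m\<in>M. \<Sum>n\<in>N. (a m * b n) * eval_monomial (m + n) z)"
    unfolding M(3) N(3) sum_product by (simp add: eval_monomial_add mult_ac)
  moreover have "poly_function V (d + e) (\<lambda>z. \<Sum>m\<in>M. \<Sum>n\<in>N. (a m * b n) * eval_monomial (m + n) z)"
  proof (intro poly_function_sum poly_function_monomial)
    fix m n assume mn: "m \<in> M" "n \<in> N"
    show "Poly_Mapping.keys (m + n) \<subseteq> V"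
      using Poly_Mapping.keys_add[of m n] M(1)[OF mn(1)] N(1)[OF mn(2)] by blast
    show "monomial_degree (m + n) \<le> d + e"
      using M(2)[OF mn(1)] N(2)[OF mn(2)] by (simp add: monomial_degree_add)
  qed
  ultimately show ?thesis by simp
qed

lemma poly_function_cmult:
  assumes "poly_function V d g"
  shows "poly_function V d (\<lambda>z. c * g z)"
  using poly_function_mult[OF poly_function_const[of V 0 c] assms] by simp

lemma poly_function_minus:
  assumes "poly_function V d g"
  shows "poly_function V d (\<lambda>z. - g z)"
  using poly_function_cmult[OF assms, of "- 1"] by simp

lemma poly_function_diff:
  assumes "poly_function V d g" "poly_function V d h"
  shows "poly_function V d (\<lambda>z. g z - h z)"
  using poly_function_add[OF assms(1) poly_function_minus[OF assms(2)]] by simp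

lemma poly_function_prod:
  assumes "\<And>i. i \<in> I \<Longrightarrow> poly_function V (d i) (g i)"
  shows "poly_function V (\<Sum>i\<in>I. d i) (\<lambda>z. \<Prod>i\<in>I. g i z)"
  using assms
  by (induction I rule: infinite_finite_induct)
    (auto intro: poly_function_const poly_function_mult)

lemma poly_function_power:
  assumes "poly_function V d g"
  shows "poly_function V (m * d) (\<lambda>z. g z ^ m)"
  using poly_function_prod[of "{..<m}" V "\<lambda>_. d" "\<lambda>_. g"] assms by simp

text \<open>Replacing each variable by a function of degree at most 1 cannot raise the degree. This
  covers both moving a polynomial to one block of coordinates and freezing one argument of a
  polynomial in two points.\<close>

lemma poly_function_subst:
  assumes "poly_function V d g" "\<And>v. v \<in> V \<Longrightarrow> poly_function W 1 (\<lambda>w. \<sigma> w v)"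
  shows "poly_function W d (\<lambda>w. g (\<sigma> w))"
proof -
  obtain M c where M: "\<And>m. m \<in> M \<Longrightarrow> Poly_Mapping.keys m \<subseteq> V"
    "\<And>m. m \<in> M \<Longrightarrow> monomial_degree m \<le> d" "g = (\<lambda>z. \<Sum>m\<in>M. c m * eval_monomial m z)"
    using poly_function_expand[OF assms(1)] by metis
  have "poly_function W d (\<lambda>w. eval_monomial m (\<sigma> w))" if m: "m \<in> M" for m
  proof -
    have "poly_function W (\<Sum>v\<in>Poly_Mapping.keys m. Poly_Mapping.lookup m v * 1)
        (\<lambda>w. \<Prod>v\<in>Poly_Mapping.keys m. \<sigma> w v ^ Poly_Mapping.lookup m v)"
      using M(1)[OF m] by (intro poly_function_prod poly_function_power assms(2)) auto
    then show ?thesis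
      using poly_function_mono M(2)[OF m] by (simp add: eval_monomial_def monomial_degree_def)
  qed
  then show ?thesis unfolding M(3) by (intro poly_function_sum poly_function_cmult) auto
qed

section \<open>Gaps and conjunctions\<close>

lemma threshold_degree_le:
  assumes "poly_function V d g" "\<And>z. z \<in> D \<Longrightarrow> 0 < h z * g (c z)"
  shows "threshold_degree V c D h \<le> d"
proof -
  obtain p where p: "indets p \<subseteq> V" "total_degree p \<le> d" "eval_rpoly p = g"
    using assms(1) unfolding poly_function_def by blast
  have "threshold_degree V c D h \<le> total_degree p"
    unfolding threshold_degree_def using p assms(2) by (intro Least_le) blast
  then show ?thesis using p(2) by simp
qed

text \<open>A \<open>LEAST\<close> carries information only once some candidate exists; the
  representation \<open>g\<close>, of any degree \<open>d\<close>, provides it.\<close>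

lemma threshold_degree_attained:
  assumes "poly_function V d g" "\<And>z. z \<in> D \<Longrightarrow> 0 < h z * g (c z)"
  obtains g' where "poly_function V (threshold_degree V c D h) g'"
    "\<And>z. z \<in> D \<Longrightarrow> 0 < h z * g' (c z)"
proof -
  let ?P = "\<lambda>d. \<exists>p. indets p \<subseteq> V \<and> total_degree p = d \<and> (\<forall>z\<in>D. 0 < h z * eval_rpoly p (c z))"
  have "\<exists>d. ?P d" using assms unfolding poly_function_def by blast
  then have "?P (threshold_degree V c D h)"
    unfolding threshold_degree_def by (rule LeastI_ex)
  then obtain p where p: "indets p \<subseteq> V" "total_degree p = threshold_degree V c D h"
    "\<forall>z\<in>D. 0 < h z * eval_rpoly p (c z)" by blast
  show thesis
    by (rule that[of "eval_rpoly p"]) (use p in \<open>auto simp: poly_function_def\<close>)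
qed

section \<open>From a gap to a sign representation of the conjunction\<close>

text \<open>For \<open>r = N / D\<close>, the sum of the \<open>m\<close>-th powers of
  \<open>r\<close> over the \<open>k\<close> blocks is below \<open>k / 2^m \<le> 1\<close> when all
  blocks are true, and a single false block already pushes it above 1. Multiplying by the positive
  product of the \<open>D^m\<close> turns the sum minus 1 into a polynomial with the same
  sign.\<close>

lemma conj_sign_representation_of_gap:
  fixes f :: "real ^ 'n \<Rightarrow> real" and N D :: "('n \<Rightarrow> real) \<Rightarrow> real"
  assumes "poly_function UNIV e N" "poly_function UNIV e D"
    and nonneg: "\<And>x. x \<in> X \<Longrightarrow> 0 \<le> N (vec_nth x)" "\<And>x. x \<in> X \<Longrightarrow> 0 < D (vec_nth x)"
    and true: "\<And>x. x \<in> X \<Longrightarrow> f x = -1 \<Longrightarrow> 2 * N (vec_nth x) < D (vec_nth x)"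
    and false: "\<And>x. x \<in> X \<Longrightarrow> f x \<noteq> -1 \<Longrightarrow> D (vec_nth x) < N (vec_nth x)"
    and "2 \<le> k" "k \<le> 2 ^ m"
  obtains G where "poly_function ({..<k} \<times> (UNIV :: 'n set)) (k * (m * e)) G"
    "\<And>z. z \<in> PiE {..<k} (\<lambda>_. X) \<Longrightarrow> 0 < conj_copies k f z * G (\<lambda>(i, j). z i $ j)"
proof -
  define G where "G z = (\<Sum>i<k. N (\<lambda>j. z (i, j)) ^ m * (\<Prod>l\<in>{..<k} - {i}. D (\<lambda>j. z (l, j)) ^ m))
      - (\<Prod>l<k. D (\<lambda>j. z (l, j)) ^ m)" for z :: "nat \<times> 'n \<Rightarrow> real"
  \<comment> \<open>A positive exponent keeps the inequalities \<open>r < 1/2\<close> and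
    \<open>1 < r\<close> strict after taking powers.\<close>
  have m: "0 < m" using assms(7,8) by (cases m) auto
  let ?V = "{..<k} \<times> (UNIV :: 'n set)"
  have block: "poly_function ?V (m * e) (\<lambda>z. Q (\<lambda>j. z (i, j)) ^ m)"
    if "poly_function UNIV e Q" "i < k" for i Q
    by (intro poly_function_power poly_function_subst[OF that(1)] poly_function_var) (use that(2) in auto)
  have "poly_function ?V (k * (m * e)) G"
    unfolding G_def[abs_def]
  proof (intro poly_function_diff poly_function_sum)
    fix i assume i: "i \<in> {..<k}"
    have "poly_function ?V (m * e + (\<Sum>l\<in>{..<k} - {i}. m * e))
      (\<lambda>z. N (\<lambda>j. z (i, j)) ^ m * (\<Prod>l\<in>{..<k} - {i}. D (\<lambda>j. z (l, j)) ^ m))"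
      by (intro poly_function_mult poly_function_prod block) (use assms i in auto)
    \<comment> \<open>One factor comes from \<open>N\<close> and \<open>k - 1\<close> come from
      \<open>D\<close>, each of degree at most \<open>m * e\<close>.\<close>
    moreover have "m * e + (\<Sum>l\<in>{..<k} - {i}. m * e) = k * (m * e)"
      using i by (cases k) auto
    ultimately show "poly_function ?V (k * (m * e))
      (\<lambda>z. N (\<lambda>j. z (i, j)) ^ m * (\<Prod>l\<in>{..<k} - {i}. D (\<lambda>j. z (l, j)) ^ m))" by simp
  next
    have "poly_function ?V (\<Sum>l<k. m * e) (\<lambda>z. \<Prod>l<k. D (\<lambda>j. z (l, j)) ^ m)"
      by (intro poly_function_prod block) (use assms in auto)
    then show "poly_function ?V (k * (m * e)) (\<lambda>z. \<Prod>l<k. D (\<lambda>j. z (l, j)) ^ m)" by simp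
  qed
  moreover have "0 < conj_copies k f z * G (\<lambda>(i, j). z i $ j)" if z: "z \<in> PiE {..<k} (\<lambda>_. X)" for z
  proof -
    define r where "r i = N (vec_nth (z i)) / D (vec_nth (z i))" for i
    define P where "P = (\<Prod>l<k. D (vec_nth (z l)) ^ m)"
    have zX: "z i \<in> X" if "i < k" for i using z that by auto
    have P: "0 < P" unfolding P_def using nonneg(2) zX by (intro prod_pos) auto
    have "G (\<lambda>(i, j). z i $ j)
        = (\<Sum>i<k. N (vec_nth (z i)) ^ m * (\<Prod>l\<in>{..<k} - {i}. D (vec_nth (z l)) ^ m)) - P"
      unfolding G_def P_def by simp
    also have "(\<Sum>i<k. N (vec_nth (z i)) ^ m * (\<Prod>l\<in>{..<k} - {i}. D (vec_nth (z l)) ^ m))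
        = (\<Sum>i<k. P * r i ^ m)"
    proof (rule sum.cong)
      fix i assume i: "i \<in> {..<k}"
      have "P = D (vec_nth (z i)) ^ m * (\<Prod>l\<in>{..<k} - {i}. D (vec_nth (z l)) ^ m)"
        unfolding P_def using i by (intro prod.remove) auto
      then show "N (vec_nth (z i)) ^ m * (\<Prod>l\<in>{..<k} - {i}. D (vec_nth (z l)) ^ m) = P * r i ^ m"
        using nonneg(2)[OF zX, of i] i by (simp add: r_def power_divide)
    qed simp
    finally have G: "G (\<lambda>(i, j). z i $ j) = P * ((\<Sum>i<k. r i ^ m) - 1)"
      by (simp add: sum_distrib_left right_diff_distrib)
    have r: "0 \<le> r i" if "i < k" for i
      unfolding r_def using nonneg[OF zX[OF that]] by simp
    show ?thesis
    proof (cases "\<forall>i<k. f (z i) = -1")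
      case True
      have "(\<Sum>i<k. r i ^ m) < (\<Sum>i<k. 1 / real k)"
      proof (rule sum_strict_mono)
        fix i assume i: "i \<in> {..<k}"
        have "r i < 1 / 2"
          using true[OF zX] nonneg(2)[OF zX] True i by (simp add: r_def field_simps)
        then have "r i ^ m < (1 / 2) ^ m" using r i m by (intro power_strict_mono) auto
        also have "(1 / 2) ^ m = 1 / real (2 ^ m)" by (simp add: power_divide)
        also have "\<dots> \<le> 1 / real k"
          using assms(7,8) by (intro divide_left_mono) (auto simp del: of_nat_power)
        finally show "r i ^ m < 1 / real k" .
      qed (use assms(7) in \<open>auto simp: lessThan_empty_iff\<close>)
      then have "(\<Sum>i<k. r i ^ m) < 1" using assms(7) by simp
      then show ?thesis using True P unfolding G conj_copies_def by (simp add: mult_less_0_iff)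
    next
      case False
      then obtain i where i: "i < k" "f (z i) \<noteq> -1" by blast
      have "1 < r i"
        using false[OF zX i(2)] nonneg(2)[OF zX] i by (simp add: r_def)
      then have "1 < r i ^ m" using m by (rule one_less_power)
      also have "\<dots> \<le> (\<Sum>i<k. r i ^ m)"
        using i r by (intro member_le_sum) auto
      finally show ?thesis using False P unfolding G conj_copies_def by auto
    qed
  qed
  ultimately show thesis using that by blast
qed

text \<open>The product of the squared distances to the true points vanishes exactly at those
  points; rescaling lifts it above 1 on the finitely many false points. Its degree is irrelevant: it
  only serves to show that a sign representation exists.\<close>

lemma interpolation_gap:
  fixes X :: "(real ^ 'n) set"
  assumes "finite X"
  obtains e N where "poly_function (UNIV :: 'n set) e N"
    "\<And>x. x \<in> X \<Longrightarrow> f x = -1 \<Longrightarrow> N (vec_nth x) = 0"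
    "\<And>x. x \<in> X \<Longrightarrow> f x \<noteq> -1 \<Longrightarrow> 1 < N (vec_nth x)"
proof -
  define T where "T = {x \<in> X. f x = -1}"
  define q where "q w = (\<Prod>t\<in>T. \<Sum>j\<in>UNIV. (w j - t $ j) ^ 2)" for w :: "'n \<Rightarrow> real"
  have finT: "finite T" using assms by (simp add: T_def)
  have "poly_function UNIV (\<Sum>t\<in>T. 2 * 1) q"
    unfolding q_def[abs_def]
    by (intro poly_function_prod poly_function_sum poly_function_power poly_function_diff
        poly_function_var poly_function_const) auto
  have zero: "q (vec_nth x) = 0" if "x \<in> T" for x
    unfolding q_def using that finT by (auto intro!: prod_zero bexI[of _ x])
  have pos: "0 < q (vec_nth x)" if "x \<notin> T" for x
    unfolding q_def
  proof (rule prod_pos)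
    fix t assume "t \<in> T"
    then have "x \<noteq> t" using that by blast
    then obtain j where "x $ j \<noteq> t $ j" by (auto simp: vec_eq_iff)
    then show "0 < (\<Sum>j\<in>UNIV. (x $ j - t $ j) ^ 2)" by (intro sum_pos2[of _ j]) auto
  qed
  \<comment> \<open>The inserted 1 keeps the minimum meaningful when there are no false points. The
    scaling by \<open>2 / \<epsilon>\<close> makes every value on a false point at least 2.\<close>
  define \<epsilon> where "\<epsilon> = Min (insert 1 ((\<lambda>x. q (vec_nth x)) ` (X - T)))"
  have eps: "0 < \<epsilon>" "\<And>x. x \<in> X - T \<Longrightarrow> \<epsilon> \<le> q (vec_nth x)"
    unfolding \<epsilon>_def using assms pos by (auto intro!: Min_le)
  show thesis
  proof (rule that[of _ "\<lambda>w. 2 / \<epsilon> * q w"])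
    show "poly_function UNIV (\<Sum>t\<in>T. 2 * 1) (\<lambda>w. 2 / \<epsilon> * q w)"
      by (rule poly_function_cmult) fact
    show "2 / \<epsilon> * q (vec_nth x) = 0" if "x \<in> X" "f x = -1" for x
      using zero that by (simp add: T_def)
    show "1 < 2 / \<epsilon> * q (vec_nth x)" if "x \<in> X" "f x \<noteq> -1" for x
      using eps(2)[of x] eps(1) that by (simp add: T_def field_simps)
  qed
qed

section \<open>From the two-fold conjunction to a gap\<close>

text \<open>After the flip on \<open>F \<times> F\<close>, the weighted sums of \<open>M\<close>
  equal \<open>A - B\<close> at points of \<open>T\<close> and \<open>A + B\<close> at points of
  \<open>F\<close>. Ville's alternative fixes the sign of these sums, either with weights on the
  second argument (first case) or with positive weights on the first argument (second case).\<close>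

lemma sign_matrix_alternative:
  fixes \<phi> :: "'b \<Rightarrow> 'b \<Rightarrow> real"
  assumes fin: "finite T" "finite F" and ne: "T \<noteq> {}" "F \<noteq> {}" and disj: "T \<inter> F = {}"
    and pos: "\<And>x y. x \<in> T \<Longrightarrow> y \<in> T \<Longrightarrow> 0 < \<phi> x y"
    and neg: "\<And>x y. x \<in> T \<union> F \<Longrightarrow> y \<in> T \<union> F \<Longrightarrow> x \<in> F \<or> y \<in> F \<Longrightarrow> \<phi> x y < 0"
  obtains
    c A B where "A = (\<lambda>x. \<Sum>y\<in>T. c y * \<phi> x y)" "B = (\<lambda>x. - (\<Sum>y\<in>F. c y * \<phi> x y))"
      "\<And>x. x \<in> T \<union> F \<Longrightarrow> 0 < B x" "\<And>x. x \<in> T \<Longrightarrow> 0 \<le> A x" "\<And>x. x \<in> T \<Longrightarrow> A x \<le> B x"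
      "\<And>x. x \<in> F \<Longrightarrow> A x \<le> - B x"
  | a A B where "A = (\<lambda>y. \<Sum>x\<in>T. a x * \<phi> x y)" "B = (\<lambda>y. - (\<Sum>x\<in>F. a x * \<phi> x y))"
      "\<And>y. y \<in> T \<union> F \<Longrightarrow> 0 < B y" "\<And>y. y \<in> T \<Longrightarrow> B y \<le> A y"
      "\<And>y. y \<in> F \<Longrightarrow> - B y \<le> A y" "\<And>y. y \<in> F \<Longrightarrow> A y \<le> 0"
proof -
  define M where "M x y = (if x \<in> F \<and> y \<in> F then - \<phi> x y else \<phi> x y)" for x y
  have M: "M x y = \<phi> x y" if "x \<in> T \<or> y \<in> T" for x y
    using that disj by (auto simp: M_def)
  have M': "M x y = - \<phi> x y" if "x \<in> F" "y \<in> F" for x y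
    using that by (simp add: M_def)
  have split: "(\<Sum>y\<in>T \<union> F. h y) = (\<Sum>y\<in>T. h y) + (\<Sum>y\<in>F. h y)" for h :: "'b \<Rightarrow> real"
    using fin disj by (intro sum.union_disjoint) auto
  have "finite (T \<union> F)" using fin by simp
  from ville_alternative[OF this this, of M] show thesis
  proof (elim disjE exE conjE)
    fix a assume a: "\<forall>x\<in>T \<union> F. 0 < a x" "\<forall>y\<in>T \<union> F. 0 < (\<Sum>x\<in>T \<union> F. a x * M x y)"
    define A where "A y = (\<Sum>x\<in>T. a x * \<phi> x y)" for y
    define B where "B y = - (\<Sum>x\<in>F. a x * \<phi> x y)" for y
    show thesis
    proof (rule that(2)[of A a B])
      show "0 < B y" if "y \<in> T \<union> F" for y
        unfolding B_def sum_negf[symmetric] using a(1) neg that fin ne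
        by (intro sum_pos) (auto simp: mult_less_0_iff)
      show "B y \<le> A y" if "y \<in> T" for y
        using a(2)[rule_format, of y] that by (simp add: split A_def B_def M)
      show "- B y \<le> A y" if "y \<in> F" for y
        using a(2)[rule_format, of y] that by (simp add: split A_def B_def M M' sum_negf)
      show "A y \<le> 0" if "y \<in> F" for y
        unfolding A_def using a(1) neg that
        by (intro sum_nonpos) (auto simp: mult_le_0_iff less_imp_le)
    qed (auto simp: A_def B_def)
  next
    fix c assume c: "\<forall>y\<in>T \<union> F. 0 \<le> c y" "\<exists>y\<in>T \<union> F. 0 < c y"
      "\<forall>x\<in>T \<union> F. (\<Sum>y\<in>T \<union> F. c y * M x y) \<le> 0"
    define A where "A x = (\<Sum>y\<in>T. c y * \<phi> x y)" for x
    define B where "B x = - (\<Sum>y\<in>F. c y * \<phi> x y)" for x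
    have A_nonneg: "0 \<le> A x" if "x \<in> T" for x
      unfolding A_def using c(1) pos that by (intro sum_nonneg) (auto simp: less_imp_le)
    have AB: "A x \<le> B x" if "x \<in> T" for x
      using c(3)[rule_format, of x] that by (simp add: split A_def B_def M)
    \<comment> \<open>This makes the denominator \<open>B\<close> positive. Were all the weight on
      \<open>T\<close>, a point of \<open>T\<close> would have \<open>A > 0 = B\<close>,
      contradicting \<open>A \<le> B\<close>.\<close>
    have "\<exists>y\<in>F. 0 < c y"
    proof (rule ccontr)
      assume "\<not> ?thesis"
      then have zero: "\<forall>y\<in>F. c y = 0" using c(1) by force
      then obtain y where y: "y \<in> T" "0 < c y" using c(2) by force
      obtain x where x: "x \<in> T" using ne by blast
      have "0 < A x"
        unfolding A_def using x y c(1) pos fin by (intro sum_pos2[of _ y]) (auto simp: less_imp_le)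
      moreover have "B x = 0" unfolding B_def using zero by simp
      ultimately show False using AB[OF x] by simp
    qed
    then obtain y where y: "y \<in> F" "0 < c y" by blast
    show thesis
    proof (rule that(1)[of A c B])
      show "0 < B x" if "x \<in> T \<union> F" for x
        unfolding B_def sum_negf[symmetric] using c(1) neg that fin y
        by (intro sum_pos2[of _ y]) (auto simp: mult_less_0_iff mult_le_0_iff less_imp_le)
      show "A x \<le> - B x" if "x \<in> F" for x
        using c(3)[rule_format, of x] that by (simp add: split A_def B_def M M' sum_negf)
    qed (use A_nonneg AB in \<open>auto simp: A_def B_def\<close>)
  qed
qed

text \<open>Summing \<open>\<psi>\<close> over frozen values of one argument leaves polynomials
  \<open>a\<close> and \<open>b\<close> of degree at most \<open>d\<close> in the other. Squaring a
  linear combination of them turns the two-sided bounds on \<open>A / B\<close> into a gap, at the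
  cost of doubling the degree.\<close>

lemma gap_of_conj_sign_representation:
  fixes f :: "real ^ 'n \<Rightarrow> real"
  assumes "finite X" and ne: "\<exists>x\<in>X. f x = -1" "\<exists>x\<in>X. f x \<noteq> -1"
    and g: "poly_function ({..<2} \<times> (UNIV :: 'n set)) d g"
    and sign: "\<And>z. z \<in> PiE {..<2} (\<lambda>_. X) \<Longrightarrow> 0 < conj_copies 2 f z * g (\<lambda>(i, j). z i $ j)"
  obtains N D where "poly_function UNIV (2 * d) N" "poly_function UNIV (2 * d) D"
    "\<And>x. x \<in> X \<Longrightarrow> 0 \<le> N (vec_nth x)" "\<And>x. x \<in> X \<Longrightarrow> 0 < D (vec_nth x)"
    "\<And>x. x \<in> X \<Longrightarrow> f x = -1 \<Longrightarrow> 2 * N (vec_nth x) < D (vec_nth x)"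
    "\<And>x. x \<in> X \<Longrightarrow> f x \<noteq> -1 \<Longrightarrow> D (vec_nth x) < N (vec_nth x)"
proof -
  define T where "T = {x \<in> X. f x = -1}"
  define F where "F = {x \<in> X. f x \<noteq> -1}"
  have X: "X = T \<union> F" by (auto simp: T_def F_def)
  \<comment> \<open>The minus sign makes \<open>\<psi>\<close> positive on pairs of true points,
    since true is encoded as -1. The value \<open>undefined\<close> at indices beyond 1 matches the
    extensional functions in \<open>PiE {..<2}\<close>.\<close>
  define \<psi> where "\<psi> u v = - g (\<lambda>(i, j). if i = 0 then u j else if i = Suc 0 then v j else undefined $ j)"
    for u v :: "'n \<Rightarrow> real"
  define \<phi> where "\<phi> x y = \<psi> (vec_nth x) (vec_nth y)" for x y
  have poly1: "poly_function UNIV d (\<lambda>u. \<psi> u v)" for v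
    unfolding \<psi>_def
  proof (intro poly_function_minus poly_function_subst[OF g])
    fix s :: "nat \<times> 'n"
    obtain i j where "s = (i, j)" by fastforce
    then show "poly_function UNIV 1
      (\<lambda>u. (\<lambda>(i, j). if i = 0 then u j else if i = Suc 0 then v j else undefined $ j) s)"
      by (cases "i = 0") (auto intro: poly_function_var poly_function_const)
  qed
  have poly2: "poly_function UNIV d (\<lambda>v. \<psi> u v)" for u
    unfolding \<psi>_def
  proof (intro poly_function_minus poly_function_subst[OF g])
    fix s :: "nat \<times> 'n"
    obtain i j where "s = (i, j)" by fastforce
    then show "poly_function UNIV 1
      (\<lambda>v. (\<lambda>(i, j). if i = 0 then u j else if i = Suc 0 then v j else undefined $ j) s)"
      by (cases "i = 0"; cases "i = Suc 0") (auto intro: poly_function_var poly_function_const)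
  qed
  have sign': "conj_copies 2 f (\<lambda>i. if i = 0 then x else if i = Suc 0 then y else undefined) * \<phi> x y < 0"
    if "x \<in> X" "y \<in> X" for x y
  proof -
    let ?z = "\<lambda>i::nat. if i = 0 then x else if i = Suc 0 then y else undefined"
    have "(\<lambda>(i, j). ?z i $ j)
        = (\<lambda>(i, j). if i = 0 then x $ j else if i = Suc 0 then y $ j else undefined $ j)"
      by auto
    then have "\<phi> x y = - g (\<lambda>(i, j). ?z i $ j)" unfolding \<phi>_def \<psi>_def by simp
    moreover have "?z \<in> PiE {..<2} (\<lambda>_. X)" using that by (auto simp: PiE_def extensional_def)
    ultimately show ?thesis using sign[of ?z] by simp
  qed
  have ex2: "(\<forall>i<2. P i) \<longleftrightarrow> P 0 \<and> P (Suc 0)" for P :: "nat \<Rightarrow> bool"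
    by (auto simp: less_2_cases_iff)
  have pos: "0 < \<phi> x y" if "x \<in> T" "y \<in> T" for x y
    using sign'[of x y] that by (simp add: conj_copies_def ex2 T_def)
  have neg: "\<phi> x y < 0" if "x \<in> T \<union> F" "y \<in> T \<union> F" "x \<in> F \<or> y \<in> F" for x y
    using sign'[of x y] that by (auto simp: conj_copies_def ex2 T_def F_def split: if_splits)
  have TF: "finite T" "finite F" "T \<noteq> {}" "F \<noteq> {}" "T \<inter> F = {}"
    using assms(1) ne by (auto simp: T_def F_def)
  show thesis
  proof (rule sign_matrix_alternative[OF TF pos neg])
    fix c A B
    assume right: "A = (\<lambda>x. \<Sum>y\<in>T. c y * \<phi> x y)" "B = (\<lambda>x. - (\<Sum>y\<in>F. c y * \<phi> x y))"
      "\<And>x. x \<in> T \<union> F \<Longrightarrow> 0 < B x" "\<And>x. x \<in> T \<Longrightarrow> 0 \<le> A x" "\<And>x. x \<in> T \<Longrightarrow> A x \<le> B x"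
      "\<And>x. x \<in> F \<Longrightarrow> A x \<le> - B x"
    define a where "a w = (\<Sum>y\<in>T. c y * \<psi> w (vec_nth y))" for w
    define b where "b w = - (\<Sum>y\<in>F. c y * \<psi> w (vec_nth y))" for w
    have ab: "a (vec_nth x) = A x" "b (vec_nth x) = B x" for x
      by (simp_all add: a_def b_def right \<phi>_def)
    have poly: "poly_function UNIV d a" "poly_function UNIV d b"
      unfolding a_def[abs_def] b_def[abs_def]
      by (intro poly_function_minus poly_function_sum poly_function_cmult poly1)+
    show thesis
    \<comment> \<open>On \<open>T\<close>, \<open>0 \<le> A \<le> B\<close> gives
      \<open>(2A - B)^2 \<le> B^2\<close>; on \<open>F\<close>, \<open>A \<le> - B\<close> gives
      \<open>(2A - B)^2 \<ge> 9 B^2\<close>. The factor 3 is chosen strictly between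
      \<open>2 * 1\<close> and 9.\<close>
    proof (rule that[of "\<lambda>w. (2 * a w - b w) ^ 2" "\<lambda>w. 3 * b w ^ 2"])
      show "poly_function UNIV (2 * d) (\<lambda>w. (2 * a w - b w) ^ 2)"
        "poly_function UNIV (2 * d) (\<lambda>w. 3 * b w ^ 2)"
        by (intro poly_function_power poly_function_diff poly_function_cmult poly)+
      fix x assume x: "x \<in> X"
      then have B: "0 < B x" using right X by simp
      show "0 < 3 * b (vec_nth x) ^ 2" using B by (simp add: ab)
      show "2 * (2 * a (vec_nth x) - b (vec_nth x)) ^ 2 < 3 * b (vec_nth x) ^ 2" if "f x = -1"
      proof -
        have "x \<in> T" using x that by (simp add: T_def)
        then have "\<bar>2 * A x - B x\<bar> \<le> \<bar>B x\<bar>" using right(4)[of x] right(5)[of x] B by linarith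
        then have "(2 * A x - B x) ^ 2 \<le> B x ^ 2" by (simp only: abs_le_square_iff)
        moreover have "0 < B x ^ 2" using B by simp
        ultimately show ?thesis unfolding ab by linarith
      qed
      show "3 * b (vec_nth x) ^ 2 < (2 * a (vec_nth x) - b (vec_nth x)) ^ 2" if "f x \<noteq> -1"
      proof -
        have "x \<in> F" using x that by (simp add: F_def)
        then have "\<bar>3 * B x\<bar> \<le> \<bar>2 * A x - B x\<bar>" using right(6)[of x] B by linarith
        then have "(3 * B x) ^ 2 \<le> (2 * A x - B x) ^ 2" by (simp only: abs_le_square_iff)
        then have "9 * B x ^ 2 \<le> (2 * A x - B x) ^ 2" by (simp add: power_mult_distrib)
        moreover have "0 < B x ^ 2" using B by simp
        ultimately show ?thesis unfolding ab by linarith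
      qed
    qed simp
  next
    fix c A B
    assume left: "A = (\<lambda>y. \<Sum>x\<in>T. c x * \<phi> x y)" "B = (\<lambda>y. - (\<Sum>x\<in>F. c x * \<phi> x y))"
      "\<And>y. y \<in> T \<union> F \<Longrightarrow> 0 < B y" "\<And>y. y \<in> T \<Longrightarrow> B y \<le> A y"
      "\<And>y. y \<in> F \<Longrightarrow> - B y \<le> A y" "\<And>y. y \<in> F \<Longrightarrow> A y \<le> 0"
    define a where "a w = (\<Sum>x\<in>T. c x * \<psi> (vec_nth x) w)" for w
    define b where "b w = - (\<Sum>x\<in>F. c x * \<psi> (vec_nth x) w)" for w
    have ab: "a (vec_nth x) = A x" "b (vec_nth x) = B x" for x
      by (simp_all add: a_def b_def left \<phi>_def)
    have poly: "poly_function UNIV d a" "poly_function UNIV d b"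
      unfolding a_def[abs_def] b_def[abs_def]
      by (intro poly_function_minus poly_function_sum poly_function_cmult poly2)+
    show thesis
    \<comment> \<open>Here the square belongs in the denominator, and \<open>2A + B\<close> may
      vanish on \<open>F\<close>, so \<open>B^2\<close> is added to keep it positive. The
      denominator is then at least \<open>10 B^2 > 6 B^2\<close> on \<open>T\<close> and at most
      \<open>2 B^2 < 3 B^2\<close> on \<open>F\<close>.\<close>
    proof (rule that[of "\<lambda>w. 3 * b w ^ 2" "\<lambda>w. (2 * a w + b w) ^ 2 + b w ^ 2"])
      show "poly_function UNIV (2 * d) (\<lambda>w. (2 * a w + b w) ^ 2 + b w ^ 2)"
        "poly_function UNIV (2 * d) (\<lambda>w. 3 * b w ^ 2)"
        by (intro poly_function_power poly_function_add poly_function_cmult poly)+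
      fix x assume x: "x \<in> X"
      then have B: "0 < B x" using left X by simp
      show "0 < (2 * a (vec_nth x) + b (vec_nth x)) ^ 2 + b (vec_nth x) ^ 2"
        using B by (simp add: ab add_nonneg_pos)
      show "2 * (3 * b (vec_nth x) ^ 2) < (2 * a (vec_nth x) + b (vec_nth x)) ^ 2 + b (vec_nth x) ^ 2"
        if "f x = -1"
      proof -
        have "x \<in> T" using x that by (simp add: T_def)
        then have "\<bar>3 * B x\<bar> \<le> \<bar>2 * A x + B x\<bar>" using left(4)[of x] B by linarith
        then have "(3 * B x) ^ 2 \<le> (2 * A x + B x) ^ 2" by (simp only: abs_le_square_iff)
        then have "9 * B x ^ 2 \<le> (2 * A x + B x) ^ 2" by (simp add: power_mult_distrib)
        moreover have "0 < B x ^ 2" using B by simp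
        ultimately show ?thesis unfolding ab by linarith
      qed
      show "(2 * a (vec_nth x) + b (vec_nth x)) ^ 2 + b (vec_nth x) ^ 2 < 3 * b (vec_nth x) ^ 2"
        if "f x \<noteq> -1"
      proof -
        have "x \<in> F" using x that by (simp add: F_def)
        then have "\<bar>2 * A x + B x\<bar> \<le> \<bar>B x\<bar>" using left(5)[of x] left(6)[of x] B by linarith
        then have "(2 * A x + B x) ^ 2 \<le> B x ^ 2" by (simp only: abs_le_square_iff)
        moreover have "0 < B x ^ 2" using B by simp
        ultimately show ?thesis unfolding ab by linarith
      qed
    qed simp
  qed
qed

section \<open>Constant functions and the final bound\<close>

text \<open>The conjunction is constant as well, so a constant polynomial represents it. For
  \<open>f\<close> nowhere true this uses \<open>0 < k\<close>, since the empty conjunction is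
  true.\<close>

lemma threshold_degree_conj_constant:
  fixes f :: "real ^ 'n \<Rightarrow> real"
  assumes "(\<forall>x\<in>X. f x = -1) \<or> (\<forall>x\<in>X. f x \<noteq> -1)" "0 < k"
  shows "threshold_degree_conj k X f = 0"
proof -
  obtain c where c: "\<And>z. z \<in> PiE {..<k} (\<lambda>_. X) \<Longrightarrow> 0 < conj_copies k f z * c"
  proof (cases "\<forall>x\<in>X. f x = -1")
    case True
    then show thesis by (intro that[of "-1"]) (auto simp: conj_copies_def PiE_iff)
  next
    case False
    then show thesis using assms
      by (intro that[of 1]) (auto simp: conj_copies_def PiE_iff)
  qed
  have "threshold_degree_conj k X f \<le> 0"
    unfolding threshold_degree_conj_def
    by (rule threshold_degree_le[OF poly_function_const[of _ _ c]]) (rule c)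
  then show ?thesis by simp
qed

theorem theorem3p23:
  fixes X :: "(real ^ 'n) set" and f :: "real ^ 'n \<Rightarrow> real" and k :: nat
  assumes "finite X"
    and "\<And>x. x \<in> X \<Longrightarrow> f x \<in> {-1, 1}"
    and "k \<ge> 2"
  shows "real (threshold_degree_conj k X f)
           \<le> (8 * real k * log 2 (real k)) * real (threshold_degree_conj 2 X f)"
proof (cases "(\<forall>x\<in>X. f x = -1) \<or> (\<forall>x\<in>X. f x \<noteq> -1)")
  case True
  then have "threshold_degree_conj k X f = 0"
    using assms(3) by (intro threshold_degree_conj_constant) auto
  then show ?thesis using assms(3) by simp
next
  case False
  define d where "d = threshold_degree_conj 2 X f"
  obtain e N where N: "poly_function (UNIV :: 'n set) e N"
    "\<And>x. x \<in> X \<Longrightarrow> f x = -1 \<Longrightarrow> N (vec_nth x) = 0"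
    "\<And>x. x \<in> X \<Longrightarrow> f x \<noteq> -1 \<Longrightarrow> 1 < N (vec_nth x)"
    using interpolation_gap[OF assms(1), of f] by metis
  have N_nonneg: "0 \<le> N (vec_nth x)" if "x \<in> X" for x
    using N(2,3)[OF that] by (cases "f x = -1") auto
  \<comment> \<open>The interpolating \<open>N\<close> over the constant denominator 1, with
    exponent 1 because \<open>2 \<le> 2^1\<close>, represents the two-fold conjunction in some
    degree. Hence its threshold degree is attained.\<close>
  obtain G where G: "poly_function ({..<2} \<times> (UNIV :: 'n set)) (2 * (1 * e)) G"
    "\<And>z. z \<in> PiE {..<2} (\<lambda>_. X) \<Longrightarrow> 0 < conj_copies 2 f z * G (\<lambda>(i, j). z i $ j)"
  proof (rule conj_sign_representation_of_gap[OF N(1) poly_function_const[of _ _ 1], of X f 2 1])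
    show "2 * N (vec_nth x) < 1" if "x \<in> X" "f x = -1" for x using N(2)[OF that] by simp
  qed (use N(3) N_nonneg in simp_all)
  obtain g where g: "poly_function ({..<2} \<times> (UNIV :: 'n set)) d g"
    "\<And>z. z \<in> PiE {..<2} (\<lambda>_. X) \<Longrightarrow> 0 < conj_copies 2 f z * g (\<lambda>(i, j). z i $ j)"
    unfolding d_def threshold_degree_conj_def
    by (rule threshold_degree_attained[of _ _ G, OF G]) auto
  obtain N D where ND: "poly_function (UNIV :: 'n set) (2 * d) N"
    "poly_function (UNIV :: 'n set) (2 * d) D"
    "\<And>x. x \<in> X \<Longrightarrow> 0 \<le> N (vec_nth x)" "\<And>x. x \<in> X \<Longrightarrow> 0 < D (vec_nth x)"
    "\<And>x. x \<in> X \<Longrightarrow> f x = -1 \<Longrightarrow> 2 * N (vec_nth x) < D (vec_nth x)"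
    "\<And>x. x \<in> X \<Longrightarrow> f x \<noteq> -1 \<Longrightarrow> D (vec_nth x) < N (vec_nth x)"
    by (rule gap_of_conj_sign_representation[OF assms(1) _ _ g]) (use False in blast)+
  define m where "m = nat \<lceil>log 2 (real k)\<rceil>"
  have log: "1 \<le> log 2 (real k)" using assms(3) by (simp add: le_log_iff)
  then have "log 2 (real k) \<le> real m" unfolding m_def by linarith
  then have "real k \<le> 2 powr real m" using assms(3) by (simp add: log_le_iff)
  then have "real k \<le> real (2 ^ m)" by (simp add: powr_realpow)
  then have km: "k \<le> 2 ^ m" by (simp only: of_nat_le_iff)
  obtain G where G: "poly_function ({..<k} \<times> (UNIV :: 'n set)) (k * (m * (2 * d))) G"
    "\<And>z. z \<in> PiE {..<k} (\<lambda>_. X) \<Longrightarrow> 0 < conj_copies k f z * G (\<lambda>(i, j). z i $ j)"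
    by (rule conj_sign_representation_of_gap[OF ND assms(3) km]) auto
  have "threshold_degree_conj k X f \<le> k * (m * (2 * d))"
    unfolding threshold_degree_conj_def by (rule threshold_degree_le[OF G(1)]) (rule G(2))
  then have "real (threshold_degree_conj k X f) \<le> real (k * (m * (2 * d)))"
    by (simp only: of_nat_le_iff)
  also have "\<dots> = 2 * real k * real m * real d" by simp
  \<comment> \<open>From \<open>k \<ge> 2\<close> the logarithm is at least 1, so rounding up gives
    \<open>m \<le> log 2 k + 1 \<le> 2 * log 2 k\<close>, which is within
    \<open>4 * log 2 k\<close>.\<close>
  also have "\<dots> \<le> 2 * real k * (4 * log 2 (real k)) * real d"
    using log unfolding m_def by (intro mult_right_mono mult_left_mono) linarith+
  finally show ?thesis by (simp add: d_def)
qed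

end
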